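(* For every formula $G$: the regular sequent $\emptyset\Rightarrow_g G$ is derivable in $\mathbf{GBU}(G)$ if and only if $G$ is not provable in $\mathbf{FRJ}(G)$ (i.e. no regular sequent $\Gamma\Rightarrow G$ is derivable in $\mathbf{FRJ}(G)$).
   Context: Formulas are built from a countably infinite set $\mathcal{V}$ of propositional variables and $\bot$ using $\land,\lor,\supset$. Let $\mathcal{V}_\bot=\mathcal{V}\cup\{\bot\}$, $\mathcal{L}^{\supset}$ the set of formulas with main connective $\supset$. For a formula $G$, $\mathrm{Sl}(G)$ and $\mathrm{Sr}(G)$ are the smallest subsets of the subformulas of $G$ with: $G\in\mathrm{Sr}(G)$; $A\land B$ or $A\lor B$ in $\mathrm{Sl}(G)$ (resp. $\mathrm{Sr}(G)$) implies $A,B$ in $\mathrm{Sl}(G)$ (resp. $\mathrm{Sr}(G)$); $A\supset B\in\mathrm{Sl}(G)$ implies $B\in\mathrm{Sl}(G)$, $A\in\mathrm{Sr}(G)$; $A\supset B\in\mathrm{Sr}(G)$ implies $B\in\mathrm{Sr}(G)$, $A\in\mathrm{Sl}(G)$. $\mathrm{Cl}(\Gamma)$ is the smallest set containing $\Gamma$ such that if $X,Y\in\mathrm{Cl}(\Gamma)$ and $A$ is any formula then $X\land Y,A\lor X,X\lor A,A\supset X\in\mathrm{Cl}(\Gamma)$. Commas denote union. $\mathbf{FRJ}(G)$: let $\bar\Gamma^{At}=\mathrm{Sl}(G)\cap\mathcal V$, $\bar\Gamma^{\supset}=\mathrm{Sl}(G)\cap\mathcal L^{\supset}$, $\bar\Gamma=\bar\Gamma^{At}\cup\bar\Gamma^{\supset}$.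 Sequents: regular $\Gamma\Rightarrow C$ ($\Gamma\subseteq\bar\Gamma$, $C\in\mathrm{Sr}(G)$), irregular $\Sigma;\Theta\rightarrow C$ ($\Sigma\cup\Theta\subseteq\bar\Gamma$, $C\in\mathrm{Sr}(G)$); conclusions always have right formula in $\mathrm{Sr}(G)$. Rules ($F\in\mathcal V_\bot$, $k\in\{1,2\}$): axioms $\bar\Gamma^{At}\setminus\{F\}\Rightarrow F$ and $\emptyset;(\bar\Gamma^{At}\setminus\{F\})\cup\bar\Gamma^{\supset}\rightarrow F$; ($\land$) $\Gamma\Rightarrow A_k/\Gamma\Rightarrow A_1\land A_2$ and $\Sigma;\Theta\rightarrow A_k/\Sigma;\Theta\rightarrow A_1\land A_2$; ($\lor$) $\Sigma_1;\Theta_1\rightarrow C_1$, $\Sigma_2;\Theta_2\rightarrow C_2 / \Sigma_1\cup\Sigma_2;\Theta_1\cap\Theta_2\rightarrow C_1\lor C_2$ if $\Sigma_1\subseteq\Sigma_2\cup\Theta_2$, $\Sigma_2\subseteq\Sigma_1\cup\Theta_1$; ($\supset_\in$) $\Gamma\Rightarrow B/\Gamma\Rightarrow A\supset B$ if $A\in\mathrm{Cl}(\Gamma)$, and $\Sigma;\Theta\cup\Lambda\rightarrow B/\Sigma\cup\Lambda;\Theta\rightarrow A\supset B$ if $\Theta\cap\Lambda=\emptyset$, $A\in\mathrm{Cl}(\Sigma\cup\Lambda)$ and no $\Lambda'\subsetneq\Lambda$ has $A\in\mathrm{Cl}(\Sigma\cup\Lambda')$; ($\supset_{\notin}$) $\Gamma\Rightarrow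 B/\emptyset;\Theta\rightarrow A\supset B$ if $\Theta\subseteq\mathrm{Cl}(\Gamma)\cap\bar\Gamma$, $A\in\mathrm{Cl}(\Gamma)\setminus\mathrm{Cl}(\Theta)$ and every $\Theta'$ with $\Theta\subsetneq\Theta'\subseteq\mathrm{Cl}(\Gamma)\cap\bar\Gamma$ has $A\in\mathrm{Cl}(\Theta')$; join rules with premises $\Sigma_j;\Theta_j\rightarrow A_j$ ($1\le j\le n$, $n\ge1$): let $\Upsilon=\{A_1,\dots,A_n\}$, $\Sigma^{At}=\bigcup_j(\Sigma_j\cap\mathcal V)$, $\Sigma^{\supset}=\bigcup_j(\Sigma_j\cap\mathcal L^{\supset})$, $\Theta^{At}=\bigcap_j(\Theta_j\cap\mathcal V)$, $\Theta^{\supset}=\{Y\supset Z\in\bigcap_j(\Theta_j\cap\mathcal L^{\supset}):Y\in\Upsilon\}$, requiring $\Sigma_i\subseteq\Sigma_j\cup\Theta_j$ ($i\ne j$) and ($Y\supset Z\in\Sigma^{\supset}\Rightarrow Y\in\Upsilon$); ($\bowtie^{At}$) conclusion $\Sigma^{At}\cup(\Theta^{At}\setminus\{F\})\cup\Sigma^{\supset}\cup\Theta^{\supset}\Rightarrow F$, $F\in\mathcal V_\bot\setminus\Sigma^{At}$, where each $Y\in\Upsilon$ has some $Y\supset Z\in\mathrm{Sl}(G)$; ($\bowtie^{\lor}$) conclusion $\Sigma^{At}\cup\Theta^{At}\cup\Sigma^{\supset}\cup\Theta^{\supset}\Rightarrow C_1\lor C_2$, $\{C_1,C_2\}\subseteq\Upsilon$,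 where each $Y\in\Upsilon$ has some $Y\supset Z\in\mathrm{Sl}(G)$ or $Y\lor Z\in\mathrm{Sr}(G)$ or $Z\lor Y\in\mathrm{Sr}(G)$. $\mathbf{GBU}(G)$: sequents regular $\Psi\Rightarrow_g A$ and irregular $\Psi\rightarrow_g A$ with $\Psi\subseteq\mathrm{Sl}(G)$, $A\in\mathrm{Sr}(G)$ (all sequents in rules satisfy this). Rules ($k\in\{1,2\}$): axioms $A,\Psi\Rightarrow_g A$, $\bot,\Psi\Rightarrow_g C$, $A,\Psi\rightarrow_g A$; $L\land$: $A,B,\Psi\Rightarrow_g C/A\land B,\Psi\Rightarrow_g C$; $R\land$: $\Psi\Rightarrow_g A$, $\Psi\Rightarrow_g B/\Psi\Rightarrow_g A\land B$ and likewise with $\rightarrow_g$ throughout; $L\lor$: $A,\Psi\Rightarrow_g C$, $B,\Psi\Rightarrow_g C/A\lor B,\Psi\Rightarrow_g C$; $R\lor_k$: $\Psi\rightarrow_g C_k/\Psi\Rightarrow_g C_1\lor C_2$ and $\Psi\rightarrow_g C_k/\Psi\rightarrow_g C_1\lor C_2$; $L\supset$: $A\supset B,\Psi\rightarrow_g A$, $B,\Psi\Rightarrow_g C/A\supset B,\Psi\Rightarrow_g C$; $\supset R_\in$: $\Psi\Rightarrow_g B/\Psi\Rightarrow_g A\supset B$ and $\Psi\rightarrow_g B/\Psi\rightarrow_g A\supset B$, if $A\in\mathrm{Cl}(\Psi)$; $\supset R_{\notin}$: $A,\Psi\Rightarrow_g B/\Psi\Rightarrow_g A\supset B$ and $A,\Psi\Rightarrow_g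 B/\Psi\rightarrow_g A\supset B$, if $A\notin\mathrm{Cl}(\Psi)$. *)

theory Defs
  imports Main
begin

datatype form =
    Var nat
  | Bot  ("\<^bold>\<bottom>")
  | And form form  (infixr "\<^bold>\<and>" 73)
  | Or form form  (infixr "\<^bold>\<or>" 72)
  | Imp form form  (infixr "\<^bold>\<supset>" 71)

definition Vars :: "form set" where
  "Vars = range Var"

definition Vars_bot :: "form set" where
  "Vars_bot = insert \<^bold>\<bottom> Vars"

definition Imps :: "form set" where
  "Imps = {A \<^bold>\<supset> B | A B. True}"

inductive_set Sl :: "form \<Rightarrow> form set" and Sr :: "form \<Rightarrow> form set" for G :: form where
  Sr_refl: "G \<in> Sr G"
| Sl_And1: "A \<^bold>\<and> B \<in> Sl G \<Longrightarrow> A \<in> Sl G"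
| Sl_And2: "A \<^bold>\<and> B \<in> Sl G \<Longrightarrow> B \<in> Sl G"
| Sl_Or1: "A \<^bold>\<or> B \<in> Sl G \<Longrightarrow> A \<in> Sl G"
| Sl_Or2: "A \<^bold>\<or> B \<in> Sl G \<Longrightarrow> B \<in> Sl G"
| Sr_And1: "A \<^bold>\<and> B \<in> Sr G \<Longrightarrow> A \<in> Sr G"
| Sr_And2: "A \<^bold>\<and> B \<in> Sr G \<Longrightarrow> B \<in> Sr G"
| Sr_Or1: "A \<^bold>\<or> B \<in> Sr G \<Longrightarrow> A \<in> Sr G"
| Sr_Or2: "A \<^bold>\<or> B \<in> Sr G \<Longrightarrow> B \<in> Sr G"
| Sl_Imp1: "A \<^bold>\<supset> B \<in> Sl G \<Longrightarrow> A \<in> Sr G"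
| Sl_Imp2: "A \<^bold>\<supset> B \<in> Sl G \<Longrightarrow> B \<in> Sl G"
| Sr_Imp1: "A \<^bold>\<supset> B \<in> Sr G \<Longrightarrow> A \<in> Sl G"
| Sr_Imp2: "A \<^bold>\<supset> B \<in> Sr G \<Longrightarrow> B \<in> Sr G"

inductive_set Cl :: "form set \<Rightarrow> form set" for \<Gamma> :: "form set" where
  Cl_base: "X \<in> \<Gamma> \<Longrightarrow> X \<in> Cl \<Gamma>"
| Cl_And: "X \<in> Cl \<Gamma> \<Longrightarrow> Y \<in> Cl \<Gamma> \<Longrightarrow> X \<^bold>\<and> Y \<in> Cl \<Gamma>"
| Cl_Or2: "X \<in> Cl \<Gamma> \<Longrightarrow> A \<^bold>\<or> X \<in> Cl \<Gamma>"
| Cl_Or1: "X \<in> Cl \<Gamma> \<Longrightarrow> X \<^bold>\<or> A \<in> Cl \<Gamma>"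
| Cl_Imp: "X \<in> Cl \<Gamma> \<Longrightarrow> A \<^bold>\<supset> X \<in> Cl \<Gamma>"

section \<open>The refutation calculus FRJ(G)\<close>

definition Gbar_At :: "form \<Rightarrow> form set" where
  "Gbar_At G = Sl G \<inter> Vars"

definition Gbar_Imp :: "form \<Rightarrow> form set" where
  "Gbar_Imp G = Sl G \<inter> Imps"

definition Gbar :: "form \<Rightarrow> form set" where
  "Gbar G = Gbar_At G \<union> Gbar_Imp G"

datatype frj_sequent =
    FReg "form set" form  (infix "\<Rightarrow>\<^sub>f" 50)
  | FIrr "form set" "form set" form  ("_ ;; _ \<rightarrow>\<^sub>f _" [51, 51, 51] 50)

fun frj_wf :: "form \<Rightarrow> frj_sequent \<Rightarrow> bool" where
  "frj_wf G (\<Gamma> \<Rightarrow>\<^sub>f C) \<longleftrightarrow> \<Gamma> \<subseteq> Gbar G \<and> C \<in> Sr G"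
| "frj_wf G (\<Sigma> ;; \<Theta> \<rightarrow>\<^sub>f C) \<longleftrightarrow> \<Sigma> \<union> \<Theta> \<subseteq> Gbar G \<and> C \<in> Sr G"

text \<open>
  The premises of a join rule are the sequents \<open>\<Sigma> j ;; \<Theta> j \<rightarrow>\<^sub>f A j\<close> for \<open>1 \<le> j \<le> n\<close>, given by
  families \<open>\<Sigma>\<close>, \<open>\<Theta>\<close>, \<open>A\<close> indexed by natural numbers; values outside \<open>{1..n}\<close> are irrelevant.
\<close>

definition join_rhs :: "nat \<Rightarrow> (nat \<Rightarrow> form) \<Rightarrow> form set" where
  "join_rhs n A = A ` {1..n}"

definition join_Sig_At :: "nat \<Rightarrow> (nat \<Rightarrow> form set) \<Rightarrow> form set" where
  "join_Sig_At n \<Sigma> = (\<Union>j\<in>{1..n}. \<Sigma> j \<inter> Vars)"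

definition join_Sig_Imp :: "nat \<Rightarrow> (nat \<Rightarrow> form set) \<Rightarrow> form set" where
  "join_Sig_Imp n \<Sigma> = (\<Union>j\<in>{1..n}. \<Sigma> j \<inter> Imps)"

definition join_Th_At :: "nat \<Rightarrow> (nat \<Rightarrow> form set) \<Rightarrow> form set" where
  "join_Th_At n \<Theta> = (\<Inter>j\<in>{1..n}. \<Theta> j \<inter> Vars)"

definition join_Th_Imp :: "nat \<Rightarrow> (nat \<Rightarrow> form set) \<Rightarrow> (nat \<Rightarrow> form) \<Rightarrow> form set" where
  "join_Th_Imp n \<Theta> A =
     {Y \<^bold>\<supset> Z | Y Z. Y \<^bold>\<supset> Z \<in> (\<Inter>j\<in>{1..n}. \<Theta> j \<inter> Imps) \<and> Y \<in> join_rhs n A}"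

definition joinable ::
  "nat \<Rightarrow> (nat \<Rightarrow> form set) \<Rightarrow> (nat \<Rightarrow> form set) \<Rightarrow> (nat \<Rightarrow> form) \<Rightarrow> bool" where
  "joinable n \<Sigma> \<Theta> A \<longleftrightarrow>
     1 \<le> n \<and>
     (\<forall>i\<in>{1..n}. \<forall>j\<in>{1..n}. i \<noteq> j \<longrightarrow> \<Sigma> i \<subseteq> \<Sigma> j \<union> \<Theta> j) \<and>
     (\<forall>Y Z. Y \<^bold>\<supset> Z \<in> join_Sig_Imp n \<Sigma> \<longrightarrow> Y \<in> join_rhs n A)"

inductive frj :: "form \<Rightarrow> frj_sequent \<Rightarrow> bool" for G :: form where
  Ax_reg:
    "\<lbrakk>F \<in> Vars_bot; frj_wf G (Gbar_At G - {F} \<Rightarrow>\<^sub>f F)\<rbrakk>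
      \<Longrightarrow> frj G (Gbar_At G - {F} \<Rightarrow>\<^sub>f F)"
| Ax_irr:
    "\<lbrakk>F \<in> Vars_bot; frj_wf G ({} ;; (Gbar_At G - {F}) \<union> Gbar_Imp G \<rightarrow>\<^sub>f F)\<rbrakk>
      \<Longrightarrow> frj G ({} ;; (Gbar_At G - {F}) \<union> Gbar_Imp G \<rightarrow>\<^sub>f F)"
| And_reg:
    "\<lbrakk>frj G (\<Gamma> \<Rightarrow>\<^sub>f A); A \<in> {A1, A2}; frj_wf G (\<Gamma> \<Rightarrow>\<^sub>f A1 \<^bold>\<and> A2)\<rbrakk>
      \<Longrightarrow> frj G (\<Gamma> \<Rightarrow>\<^sub>f A1 \<^bold>\<and> A2)"
| And_irr:
    "\<lbrakk>frj G (\<Sigma> ;; \<Theta> \<rightarrow>\<^sub>f A); A \<in> {A1, A2}; frj_wf G (\<Sigma> ;; \<Theta> \<rightarrow>\<^sub>f A1 \<^bold>\<and> A2)\<rbrakk>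
      \<Longrightarrow> frj G (\<Sigma> ;; \<Theta> \<rightarrow>\<^sub>f A1 \<^bold>\<and> A2)"
| Or_irr:
    "\<lbrakk>frj G (\<Sigma>1 ;; \<Theta>1 \<rightarrow>\<^sub>f C1); frj G (\<Sigma>2 ;; \<Theta>2 \<rightarrow>\<^sub>f C2);
      \<Sigma>1 \<subseteq> \<Sigma>2 \<union> \<Theta>2; \<Sigma>2 \<subseteq> \<Sigma>1 \<union> \<Theta>1;
      frj_wf G (\<Sigma>1 \<union> \<Sigma>2 ;; \<Theta>1 \<inter> \<Theta>2 \<rightarrow>\<^sub>f C1 \<^bold>\<or> C2)\<rbrakk>
      \<Longrightarrow> frj G (\<Sigma>1 \<union> \<Sigma>2 ;; \<Theta>1 \<inter> \<Theta>2 \<rightarrow>\<^sub>f C1 \<^bold>\<or> C2)"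
| Imp_in_reg:
    "\<lbrakk>frj G (\<Gamma> \<Rightarrow>\<^sub>f B); A \<in> Cl \<Gamma>; frj_wf G (\<Gamma> \<Rightarrow>\<^sub>f A \<^bold>\<supset> B)\<rbrakk>
      \<Longrightarrow> frj G (\<Gamma> \<Rightarrow>\<^sub>f A \<^bold>\<supset> B)"
| Imp_in_irr:
    "\<lbrakk>frj G (\<Sigma> ;; \<Theta> \<union> \<Lambda> \<rightarrow>\<^sub>f B); \<Theta> \<inter> \<Lambda> = {};
      A \<in> Cl (\<Sigma> \<union> \<Lambda>); \<not> (\<exists>\<Lambda>'. \<Lambda>' \<subset> \<Lambda> \<and> A \<in> Cl (\<Sigma> \<union> \<Lambda>'));
      frj_wf G (\<Sigma> \<union> \<Lambda> ;; \<Theta> \<rightarrow>\<^sub>f A \<^bold>\<supset> B)\<rbrakk>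
      \<Longrightarrow> frj G (\<Sigma> \<union> \<Lambda> ;; \<Theta> \<rightarrow>\<^sub>f A \<^bold>\<supset> B)"
| Imp_notin:
    "\<lbrakk>frj G (\<Gamma> \<Rightarrow>\<^sub>f B); \<Theta> \<subseteq> Cl \<Gamma> \<inter> Gbar G; A \<in> Cl \<Gamma> - Cl \<Theta>;
      \<forall>\<Theta>'. \<Theta> \<subset> \<Theta>' \<and> \<Theta>' \<subseteq> Cl \<Gamma> \<inter> Gbar G \<longrightarrow> A \<in> Cl \<Theta>';
      frj_wf G ({} ;; \<Theta> \<rightarrow>\<^sub>f A \<^bold>\<supset> B)\<rbrakk>
      \<Longrightarrow> frj G ({} ;; \<Theta> \<rightarrow>\<^sub>f A \<^bold>\<supset> B)"
| Join_At:
    "\<lbrakk>\<And>j. j \<in> {1..n} \<Longrightarrow> frj G (\<Sigma> j ;; \<Theta> j \<rightarrow>\<^sub>f A j);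
      joinable n \<Sigma> \<Theta> A;
      \<forall>Y\<in>join_rhs n A. \<exists>Z. Y \<^bold>\<supset> Z \<in> Sl G;
      F \<in> Vars_bot - join_Sig_At n \<Sigma>;
      \<Gamma> = join_Sig_At n \<Sigma> \<union> (join_Th_At n \<Theta> - {F}) \<union> join_Sig_Imp n \<Sigma> \<union> join_Th_Imp n \<Theta> A;
      frj_wf G (\<Gamma> \<Rightarrow>\<^sub>f F)\<rbrakk>
      \<Longrightarrow> frj G (\<Gamma> \<Rightarrow>\<^sub>f F)"
| Join_Or:
    "\<lbrakk>\<And>j. j \<in> {1..n} \<Longrightarrow> frj G (\<Sigma> j ;; \<Theta> j \<rightarrow>\<^sub>f A j);
      joinable n \<Sigma> \<Theta> A;
      \<forall>Y\<in>join_rhs n A. \<exists>Z. Y \<^bold>\<supset> Z \<in> Sl G \<or> Y \<^bold>\<or> Z \<in> Sr G \<or> Z \<^bold>\<or> Y \<in> Sr G;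
      {C1, C2} \<subseteq> join_rhs n A;
      \<Gamma> = join_Sig_At n \<Sigma> \<union> join_Th_At n \<Theta> \<union> join_Sig_Imp n \<Sigma> \<union> join_Th_Imp n \<Theta> A;
      frj_wf G (\<Gamma> \<Rightarrow>\<^sub>f C1 \<^bold>\<or> C2)\<rbrakk>
      \<Longrightarrow> frj G (\<Gamma> \<Rightarrow>\<^sub>f C1 \<^bold>\<or> C2)"

definition frj_provable :: "form \<Rightarrow> bool" where
  "frj_provable G \<longleftrightarrow> (\<exists>\<Gamma>. frj G (\<Gamma> \<Rightarrow>\<^sub>f G))"

section \<open>The sequent calculus GBU(G)\<close>

datatype gbu_sequent =
    GReg "form set" form  (infix "\<Rightarrow>\<^sub>g" 50)
  | GIrr "form set" form  (infix "\<rightarrow>\<^sub>g" 50)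

fun gbu_wf :: "form \<Rightarrow> gbu_sequent \<Rightarrow> bool" where
  "gbu_wf G (\<Psi> \<Rightarrow>\<^sub>g A) \<longleftrightarrow> \<Psi> \<subseteq> Sl G \<and> A \<in> Sr G"
| "gbu_wf G (\<Psi> \<rightarrow>\<^sub>g A) \<longleftrightarrow> \<Psi> \<subseteq> Sl G \<and> A \<in> Sr G"

text \<open>
  Antecedents are sets, so \<open>insert A \<Psi>\<close> does not exclude \<open>A \<in> \<Psi>\<close>. In both calculi
  well-formedness is demanded of every conclusion, hence holds of all derivable sequents, and
  so of all premises.
\<close>

inductive gbu :: "form \<Rightarrow> gbu_sequent \<Rightarrow> bool" for G :: form where
  Ax_reg:
    "gbu_wf G (insert A \<Psi> \<Rightarrow>\<^sub>g A) \<Longrightarrow> gbu G (insert A \<Psi> \<Rightarrow>\<^sub>g A)"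
| Ax_bot:
    "gbu_wf G (insert \<^bold>\<bottom> \<Psi> \<Rightarrow>\<^sub>g C) \<Longrightarrow> gbu G (insert \<^bold>\<bottom> \<Psi> \<Rightarrow>\<^sub>g C)"
| Ax_irr:
    "gbu_wf G (insert A \<Psi> \<rightarrow>\<^sub>g A) \<Longrightarrow> gbu G (insert A \<Psi> \<rightarrow>\<^sub>g A)"
| L_And:
    "\<lbrakk>gbu G (insert A (insert B \<Psi>) \<Rightarrow>\<^sub>g C); gbu_wf G (insert (A \<^bold>\<and> B) \<Psi> \<Rightarrow>\<^sub>g C)\<rbrakk>
      \<Longrightarrow> gbu G (insert (A \<^bold>\<and> B) \<Psi> \<Rightarrow>\<^sub>g C)"
| R_And_reg:
    "\<lbrakk>gbu G (\<Psi> \<Rightarrow>\<^sub>g A); gbu G (\<Psi> \<Rightarrow>\<^sub>g B); gbu_wf G (\<Psi> \<Rightarrow>\<^sub>g A \<^bold>\<and> B)\<rbrakk>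
      \<Longrightarrow> gbu G (\<Psi> \<Rightarrow>\<^sub>g A \<^bold>\<and> B)"
| R_And_irr:
    "\<lbrakk>gbu G (\<Psi> \<rightarrow>\<^sub>g A); gbu G (\<Psi> \<rightarrow>\<^sub>g B); gbu_wf G (\<Psi> \<rightarrow>\<^sub>g A \<^bold>\<and> B)\<rbrakk>
      \<Longrightarrow> gbu G (\<Psi> \<rightarrow>\<^sub>g A \<^bold>\<and> B)"
| L_Or:
    "\<lbrakk>gbu G (insert A \<Psi> \<Rightarrow>\<^sub>g C); gbu G (insert B \<Psi> \<Rightarrow>\<^sub>g C);
      gbu_wf G (insert (A \<^bold>\<or> B) \<Psi> \<Rightarrow>\<^sub>g C)\<rbrakk>
      \<Longrightarrow> gbu G (insert (A \<^bold>\<or> B) \<Psi> \<Rightarrow>\<^sub>g C)"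
| R_Or_reg:
    "\<lbrakk>gbu G (\<Psi> \<rightarrow>\<^sub>g C); C \<in> {C1, C2}; gbu_wf G (\<Psi> \<Rightarrow>\<^sub>g C1 \<^bold>\<or> C2)\<rbrakk>
      \<Longrightarrow> gbu G (\<Psi> \<Rightarrow>\<^sub>g C1 \<^bold>\<or> C2)"
| R_Or_irr:
    "\<lbrakk>gbu G (\<Psi> \<rightarrow>\<^sub>g C); C \<in> {C1, C2}; gbu_wf G (\<Psi> \<rightarrow>\<^sub>g C1 \<^bold>\<or> C2)\<rbrakk>
      \<Longrightarrow> gbu G (\<Psi> \<rightarrow>\<^sub>g C1 \<^bold>\<or> C2)"
| L_Imp:
    "\<lbrakk>gbu G (insert (A \<^bold>\<supset> B) \<Psi> \<rightarrow>\<^sub>g A); gbu G (insert B \<Psi> \<Rightarrow>\<^sub>g C);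
      gbu_wf G (insert (A \<^bold>\<supset> B) \<Psi> \<Rightarrow>\<^sub>g C)\<rbrakk>
      \<Longrightarrow> gbu G (insert (A \<^bold>\<supset> B) \<Psi> \<Rightarrow>\<^sub>g C)"
| R_Imp_in_reg:
    "\<lbrakk>gbu G (\<Psi> \<Rightarrow>\<^sub>g B); A \<in> Cl \<Psi>; gbu_wf G (\<Psi> \<Rightarrow>\<^sub>g A \<^bold>\<supset> B)\<rbrakk>
      \<Longrightarrow> gbu G (\<Psi> \<Rightarrow>\<^sub>g A \<^bold>\<supset> B)"
| R_Imp_in_irr:
    "\<lbrakk>gbu G (\<Psi> \<rightarrow>\<^sub>g B); A \<in> Cl \<Psi>; gbu_wf G (\<Psi> \<rightarrow>\<^sub>g A \<^bold>\<supset> B)\<rbrakk>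
      \<Longrightarrow> gbu G (\<Psi> \<rightarrow>\<^sub>g A \<^bold>\<supset> B)"
| R_Imp_notin_reg:
    "\<lbrakk>gbu G (insert A \<Psi> \<Rightarrow>\<^sub>g B); A \<notin> Cl \<Psi>; gbu_wf G (\<Psi> \<Rightarrow>\<^sub>g A \<^bold>\<supset> B)\<rbrakk>
      \<Longrightarrow> gbu G (\<Psi> \<Rightarrow>\<^sub>g A \<^bold>\<supset> B)"
| R_Imp_notin_irr:
    "\<lbrakk>gbu G (insert A \<Psi> \<Rightarrow>\<^sub>g B); A \<notin> Cl \<Psi>; gbu_wf G (\<Psi> \<rightarrow>\<^sub>g A \<^bold>\<supset> B)\<rbrakk>
      \<Longrightarrow> gbu G (\<Psi> \<rightarrow>\<^sub>g A \<^bold>\<supset> B)"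

end

theory Submission imports Defs begin

text \<open>
  Soundness: the antecedents \<open>\<Gamma>\<close> of the derivable regular sequents of FRJ, ordered by
  \<open>\<Gamma> \<subseteq> Cl \<Gamma>'\<close> and with the variables of \<open>\<Gamma>\<close> true at \<open>\<Gamma>\<close>, form a single Kripke model in which
  \<open>\<Gamma>\<close> forces \<open>Cl \<Gamma>\<close>, while \<open>\<Gamma>\<close> does not force \<open>C\<close> if \<open>\<Gamma> \<Rightarrow> C\<close> is derivable, or if
  \<open>\<Sigma>;\<Theta> \<rightarrow> C\<close> is derivable with \<open>\<Sigma> \<subseteq> \<Gamma> \<subseteq> \<Sigma> \<union> \<Theta>\<close>. Since GBU is sound for Kripke models, its
  theorems are not refutable.

  Completeness: backward proof search in GBU terminates because no rule shrinks the closure of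
  the antecedent and, while it stays the same, passing from regular to irregular sequents is
  irreversible and all other steps simplify formulas. The non-invertible branches of a failed search are assembled
  into an FRJ refutation; a failed regular sequent \<open>\<Psi> \<Rightarrow> C\<close> yields \<open>\<Gamma> \<Rightarrow> C\<close> with \<open>\<Psi> \<subseteq> Cl \<Gamma>\<close>, a
  failed irregular sequent \<open>\<Psi> \<rightarrow> C\<close> yields \<open>\<Sigma>;\<Theta> \<rightarrow> C\<close> with \<open>\<Sigma> \<subseteq> \<Psi> \<subseteq> \<Sigma> \<union> \<Theta>\<close>.
\<close>

section \<open>Closures and subformulas\<close>

lemma Cl_least: "X \<in> Cl \<Gamma> \<Longrightarrow> \<Gamma> \<subseteq> Cl \<Delta> \<Longrightarrow> X \<in> Cl \<Delta>"
  by (induction rule: Cl.induct) (auto intro: Cl.intros)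

lemma Cl_mono: "\<Gamma> \<subseteq> \<Delta> \<Longrightarrow> Cl \<Gamma> \<subseteq> Cl \<Delta>"
  by (meson Cl_base Cl_least subset_eq)

lemma Cl_Var_iff [simp]: "Var p \<in> Cl \<Gamma> \<longleftrightarrow> Var p \<in> \<Gamma>"
  and Cl_Bot_iff [simp]: "\<^bold>\<bottom> \<in> Cl \<Gamma> \<longleftrightarrow> \<^bold>\<bottom> \<in> \<Gamma>"
  and Cl_And_iff: "A \<^bold>\<and> B \<in> Cl \<Gamma> \<longleftrightarrow> A \<^bold>\<and> B \<in> \<Gamma> \<or> (A \<in> Cl \<Gamma> \<and> B \<in> Cl \<Gamma>)"
  and Cl_Or_iff: "A \<^bold>\<or> B \<in> Cl \<Gamma> \<longleftrightarrow> A \<^bold>\<or> B \<in> \<Gamma> \<or> A \<in> Cl \<Gamma> \<or> B \<in> Cl \<Gamma>"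
  and Cl_Imp_iff: "A \<^bold>\<supset> B \<in> Cl \<Gamma> \<longleftrightarrow> A \<^bold>\<supset> B \<in> \<Gamma> \<or> B \<in> Cl \<Gamma>"
  by (auto intro: Cl.intros elim: Cl.cases)

text \<open>Serves to bound \<open>Sl G\<close> by a finite set; termination of the search and the
  choice of minimal and maximal sets below rest on this.\<close>

primrec subformulas :: "form \<Rightarrow> form set" where
  "subformulas (Var p) = {Var p}"
| "subformulas \<^bold>\<bottom> = {\<^bold>\<bottom>}"
| "subformulas (A \<^bold>\<and> B) = insert (A \<^bold>\<and> B) (subformulas A \<union> subformulas B)"
| "subformulas (A \<^bold>\<or> B) = insert (A \<^bold>\<or> B) (subformulas A \<union> subformulas B)"
| "subformulas (A \<^bold>\<supset> B) = insert (A \<^bold>\<supset> B) (subformulas A \<union> subformulas B)"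

lemma finite_subformulas: "finite (subformulas A)"
  by (induction A) auto

lemma subformulas_refl: "A \<in> subformulas A"
  by (cases A) auto

lemma subformulas_trans: "A \<in> subformulas B \<Longrightarrow> subformulas A \<subseteq> subformulas B"
  by (induction B) auto

lemma Sl_Sr_subformulas:
  "X \<in> Sl G \<Longrightarrow> X \<in> subformulas G" "X \<in> Sr G \<Longrightarrow> X \<in> subformulas G"
proof (induction rule: Sl_Sr.inducts)
qed (use subformulas_refl subformulas_trans in fastforce)+

lemma finite_Sl: "finite (Sl G)"
  by (meson Sl_Sr_subformulas(1) finite_subformulas finite_subset subsetI)

lemma Gbar_subset_Sl: "Gbar G \<subseteq> Sl G"
  by (auto simp: Gbar_def Gbar_At_def Gbar_Imp_def)

lemma Gbar_Un: "Gbar G = (Gbar G \<inter> Vars) \<union> (Gbar G \<inter> Imps)"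
  by (auto simp: Gbar_def Gbar_At_def Gbar_Imp_def)

lemma Gbar_notin [simp]: "\<^bold>\<bottom> \<notin> Gbar G" "A \<^bold>\<and> B \<notin> Gbar G" "A \<^bold>\<or> B \<notin> Gbar G"
  by (auto simp: Gbar_def Gbar_At_def Gbar_Imp_def Vars_def Imps_def)

section \<open>Kripke models\<close>

text \<open>A preorder and not a partial order, since distinct sets of formulas can have the same
  closure.\<close>

locale kripke =
  fixes W :: "'w set" and le :: "'w \<Rightarrow> 'w \<Rightarrow> bool" and V :: "'w \<Rightarrow> nat \<Rightarrow> bool"
  assumes le_refl: "w \<in> W \<Longrightarrow> le w w"
    and le_trans: "\<lbrakk>le u v; le v w\<rbrakk> \<Longrightarrow> le u w"
    and V_mono: "\<lbrakk>le v w; V v p\<rbrakk> \<Longrightarrow> V w p"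
begin

primrec forces :: "form \<Rightarrow> 'w \<Rightarrow> bool" where
  "forces (Var p) w \<longleftrightarrow> V w p"
| "forces \<^bold>\<bottom> w \<longleftrightarrow> False"
| "forces (A \<^bold>\<and> B) w \<longleftrightarrow> forces A w \<and> forces B w"
| "forces (A \<^bold>\<or> B) w \<longleftrightarrow> forces A w \<or> forces B w"
| "forces (A \<^bold>\<supset> B) w \<longleftrightarrow> (\<forall>v\<in>W. le w v \<longrightarrow> forces A v \<longrightarrow> forces B v)"

lemma forces_mono: "forces A v \<Longrightarrow> le v w \<Longrightarrow> forces A w"
proof (induction A)
  case (Imp A B)
  then show ?case by (auto dest: le_trans)
qed (auto dest: V_mono)

text \<open>Both kinds of sequents mean the same; the distinction only steers the search.\<close>

fun valid :: "gbu_sequent \<Rightarrow> bool" where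
  "valid (\<Psi> \<Rightarrow>\<^sub>g C) \<longleftrightarrow> (\<forall>w\<in>W. (\<forall>X\<in>\<Psi>. forces X w) \<longrightarrow> forces C w)"
| "valid (\<Psi> \<rightarrow>\<^sub>g C) \<longleftrightarrow> (\<forall>w\<in>W. (\<forall>X\<in>\<Psi>. forces X w) \<longrightarrow> forces C w)"

text \<open>For implications on the right, the antecedent persists to every later world, where the
  premise applies. For those on the left, reflexivity lets the implication act at the world
  itself.\<close>

lemma gbu_sound: "gbu G s \<Longrightarrow> valid s"
proof (induction rule: gbu.induct)
  case (L_Imp A B \<Psi> C)
  then show ?case using le_refl by fastforce
next
  case (R_Imp_in_reg \<Psi> B A)
  then show ?case by simp (blast intro: forces_mono)
next
  case (R_Imp_in_irr \<Psi> B A)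
  then show ?case by simp (blast intro: forces_mono)
next
  case (R_Imp_notin_reg A \<Psi> B)
  then show ?case by simp (blast intro: forces_mono)
next
  case (R_Imp_notin_irr A \<Psi> B)
  then show ?case by simp (blast intro: forces_mono)
qed auto

end

section \<open>Refutations yield countermodels\<close>

lemma frj_derivable_wf: "frj G s \<Longrightarrow> frj_wf G s"
  by (induction rule: frj.induct) auto

definition frj_worlds :: "form \<Rightarrow> form set set" where
  "frj_worlds G = {\<Gamma>. \<exists>C. frj G (\<Gamma> \<Rightarrow>\<^sub>f C)}"

interpretation frj: kripke "frj_worlds G" "\<lambda>\<Gamma> \<Gamma>'. \<Gamma> \<subseteq> Cl \<Gamma>'" "\<lambda>\<Gamma> p. Var p \<in> \<Gamma>" for G
proof
  show "\<Gamma> \<subseteq> Cl \<Gamma>" for \<Gamma>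
    by (auto intro: Cl_base)
  show "\<Gamma> \<subseteq> Cl \<Gamma>''" if "\<Gamma> \<subseteq> Cl \<Gamma>'" "\<Gamma>' \<subseteq> Cl \<Gamma>''" for \<Gamma> \<Gamma>' \<Gamma>''
    using that by (meson Cl_least subset_iff)
  \<comment> \<open>The closure adds no variables.\<close>
  show "Var p \<in> \<Gamma>'" if "\<Gamma> \<subseteq> Cl \<Gamma>'" "Var p \<in> \<Gamma>" for \<Gamma> \<Gamma>' p
    using that by auto
qed

lemma frj_world_subset_Gbar: "\<Gamma> \<in> frj_worlds G \<Longrightarrow> \<Gamma> \<subseteq> Gbar G"
  unfolding frj_worlds_def using frj_derivable_wf by fastforce

text \<open>\<open>\<Sigma> j\<close> has only variables and implications, all of which the join
  collects. Conversely, a formula of \<Gamma> comes from some \<open>\<Sigma> i\<close>, which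
  joinability puts inside \<open>\<Sigma> j \<union> \<Theta> j\<close>, or lies in every \<Theta>.
  Hence each premise speaks about the world \<Gamma>.\<close>

lemma join_between:
  assumes wf: "\<And>j. j \<in> {1..n} \<Longrightarrow> \<Sigma> j \<union> \<Theta> j \<subseteq> Gbar G"
    and join: "joinable n \<Sigma> \<Theta> A"
    and F: "F \<notin> join_Sig_At n \<Sigma>"
    and \<Gamma>: "\<Gamma> = join_Sig_At n \<Sigma> \<union> (join_Th_At n \<Theta> - {F}) \<union> join_Sig_Imp n \<Sigma> \<union> join_Th_Imp n \<Theta> A"
    and j: "j \<in> {1..n}"
  shows "\<Sigma> j \<subseteq> \<Gamma> \<and> \<Gamma> \<subseteq> \<Sigma> j \<union> \<Theta> j"
proof
  have "\<Sigma> j \<subseteq> Vars \<union> Imps"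
    using wf[OF j] Gbar_Un[of G] by blast
  then show "\<Sigma> j \<subseteq> \<Gamma>"
    using j unfolding \<Gamma> join_Sig_At_def join_Sig_Imp_def by blast
  have "\<Sigma> i \<subseteq> \<Sigma> j \<union> \<Theta> j" if "i \<in> {1..n}" for i
    using join j that unfolding joinable_def by (cases "i = j") auto
  then show "\<Gamma> \<subseteq> \<Sigma> j \<union> \<Theta> j"
    using j unfolding \<Gamma> join_Sig_At_def join_Sig_Imp_def join_Th_At_def join_Th_Imp_def by blast
qed

text \<open>Joinability restricts the implications taken from the \<Sigma>s, and the definition of
  \<open>join_Th_Imp\<close> those taken from the \<Theta>s, to antecedents that some premise
  refutes.\<close>

lemma join_Imp_rhs:
  assumes "joinable n \<Sigma> \<Theta> A" "Y \<^bold>\<supset> Z \<in> \<Gamma>"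
    and "\<Gamma> = join_Sig_At n \<Sigma> \<union> (join_Th_At n \<Theta> - {F}) \<union> join_Sig_Imp n \<Sigma> \<union> join_Th_Imp n \<Theta> A"
    and "1 \<le> n"
  shows "Y \<in> join_rhs n A"
proof -
  have "join_Sig_At n \<Sigma> \<subseteq> Vars" "join_Th_At n \<Theta> \<subseteq> Vars"
    using \<open>1 \<le> n\<close> by (auto simp: join_Sig_At_def join_Th_At_def)
  then have "Y \<^bold>\<supset> Z \<in> join_Sig_Imp n \<Sigma> \<union> join_Th_Imp n \<Theta> A"
    using assms(2,3) by (auto simp: Vars_def)
  then show ?thesis
    using assms(1) by (auto simp: joinable_def join_Th_Imp_def)
qed

text \<open>The join for disjunctions is the case \<open>F = \<^bold>\<bottom>\<close> of the antecedent of the atomic join.\<close>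

lemma join_Th_At_Bot: "1 \<le> n \<Longrightarrow> join_Th_At n \<Theta> - {\<^bold>\<bottom>} = join_Th_At n \<Theta>"
  and join_Sig_At_Bot: "\<^bold>\<bottom> \<notin> join_Sig_At n \<Sigma>"
  by (auto simp: join_Th_At_def join_Sig_At_def Vars_def)

text \<open>Regular axioms have no implications on the left, the one-premise rules keep \<Gamma>,
  and in a join some premise has right formula \<open>Y\<close>.\<close>

lemma frj_antecedent_Imp:
  assumes "frj G (\<Gamma> \<Rightarrow>\<^sub>f C)" "Y \<^bold>\<supset> Z \<in> \<Gamma>"
  shows "\<exists>\<Sigma> \<Theta>. frj G (\<Sigma> ;; \<Theta> \<rightarrow>\<^sub>f Y) \<and> \<Sigma> \<subseteq> \<Gamma> \<and> \<Gamma> \<subseteq> \<Sigma> \<union> \<Theta>"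
  using assms
proof (induction "\<Gamma> \<Rightarrow>\<^sub>f C" arbitrary: C rule: frj.induct)
  case (Ax_reg F)
  then show ?case by (auto simp: Gbar_At_def Vars_def)
next
  case (Join_At n \<Sigma> \<Theta> A F)
  have n: "1 \<le> n" using Join_At by (simp add: joinable_def)
  obtain j where j: "j \<in> {1..n}" "A j = Y"
    using join_Imp_rhs[OF Join_At(2,7,5) n] by (auto simp: join_rhs_def)
  have "\<And>j. j \<in> {1..n} \<Longrightarrow> \<Sigma> j \<union> \<Theta> j \<subseteq> Gbar G"
    using Join_At(1) frj_derivable_wf by fastforce
  moreover have "F \<notin> join_Sig_At n \<Sigma>" using Join_At(4) by simp
  ultimately have "\<Sigma> j \<subseteq> \<Gamma> \<and> \<Gamma> \<subseteq> \<Sigma> j \<union> \<Theta> j"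
    by (rule join_between[OF _ Join_At(2) _ Join_At(5) j(1)])
  then show ?case using Join_At(1)[OF j(1)] j(2) by metis
next
  case (Join_Or n \<Sigma> \<Theta> A C1 C2)
  have n: "1 \<le> n" using Join_Or by (simp add: joinable_def)
  have \<Gamma>: "\<Gamma> = join_Sig_At n \<Sigma> \<union> (join_Th_At n \<Theta> - {\<^bold>\<bottom>}) \<union> join_Sig_Imp n \<Sigma> \<union> join_Th_Imp n \<Theta> A"
    unfolding join_Th_At_Bot[OF n] by (fact Join_Or(5))
  obtain j where j: "j \<in> {1..n}" "A j = Y"
    using join_Imp_rhs[OF Join_Or(2,7) \<Gamma> n] by (auto simp: join_rhs_def)
  have "\<And>j. j \<in> {1..n} \<Longrightarrow> \<Sigma> j \<union> \<Theta> j \<subseteq> Gbar G"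
    using Join_Or(1) frj_derivable_wf by fastforce
  then have "\<Sigma> j \<subseteq> \<Gamma> \<and> \<Gamma> \<subseteq> \<Sigma> j \<union> \<Theta> j"
    by (rule join_between[OF _ Join_Or(2) join_Sig_At_Bot \<Gamma> j(1)])
  then show ?case using Join_Or(1)[OF j(1)] j(2) by metis
qed auto

text \<open>Only a join derives a regular sequent with a disjunction on the right, and both
  disjuncts are right formulas of its premises.\<close>

lemma frj_Or_reg_premises:
  assumes "frj G (\<Gamma> \<Rightarrow>\<^sub>f C1 \<^bold>\<or> C2)" "C \<in> {C1, C2}"
  shows "\<exists>\<Sigma> \<Theta>. frj G (\<Sigma> ;; \<Theta> \<rightarrow>\<^sub>f C) \<and> \<Sigma> \<subseteq> \<Gamma> \<and> \<Gamma> \<subseteq> \<Sigma> \<union> \<Theta>"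
  using assms(1)
proof cases
  case (Join_Or n \<Sigma> \<Theta> A)
  have n: "1 \<le> n" using Join_Or by (simp add: joinable_def)
  have \<Gamma>: "\<Gamma> = join_Sig_At n \<Sigma> \<union> (join_Th_At n \<Theta> - {\<^bold>\<bottom>}) \<union> join_Sig_Imp n \<Sigma> \<union> join_Th_Imp n \<Theta> A"
    unfolding join_Th_At_Bot[OF n] by (fact Join_Or(5))
  obtain j where j: "j \<in> {1..n}" "A j = C"
    using Join_Or(4) assms(2) by (auto simp: join_rhs_def)
  have "\<And>j. j \<in> {1..n} \<Longrightarrow> \<Sigma> j \<union> \<Theta> j \<subseteq> Gbar G"
    using Join_Or(1) frj_derivable_wf by fastforce
  then have "\<Sigma> j \<subseteq> \<Gamma> \<and> \<Gamma> \<subseteq> \<Sigma> j \<union> \<Theta> j"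
    by (rule join_between[OF _ Join_Or(2) join_Sig_At_Bot \<Gamma> j(1)])
  then show ?thesis using Join_Or(1)[OF j(1)] j(2) by metis
qed (auto simp: Vars_bot_def Vars_def)

text \<open>Only axioms and the atomic join have an atomic right formula \<open>F\<close>. They
  remove \<open>F\<close> from the variables they keep, the join also requires \<open>F\<close> to
  be outside its \<Sigma>s, and the rest are implications.\<close>

lemma frj_atom_notin:
  assumes "F \<in> Vars_bot"
  shows "frj G (\<Gamma> \<Rightarrow>\<^sub>f F) \<Longrightarrow> F \<notin> \<Gamma>"
    and "frj G (\<Sigma> ;; \<Theta> \<rightarrow>\<^sub>f F) \<Longrightarrow> F \<notin> \<Sigma> \<union> \<Theta>"
proof -
  assume "frj G (\<Gamma> \<Rightarrow>\<^sub>f F)"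
  then show "F \<notin> \<Gamma>"
    using assms
    by cases (auto simp: Vars_bot_def Vars_def join_Sig_Imp_def join_Th_Imp_def Imps_def)
next
  assume "frj G (\<Sigma> ;; \<Theta> \<rightarrow>\<^sub>f F)"
  then show "F \<notin> \<Sigma> \<union> \<Theta>"
    using assms
    by cases (auto simp: Vars_bot_def Vars_def Gbar_Imp_def Imps_def Gbar_At_def)
qed

text \<open>
  The three claims depend on each other, but always for proper subformulas of \<open>X\<close>: an implication
  \<open>Y \<^bold>\<supset> Z\<close> in a world is forced because \<open>Y\<close> is refuted there.
\<close>

lemma frj_countermodel:
  assumes "\<Gamma> \<in> frj_worlds G"
  shows "X \<in> Cl \<Gamma> \<Longrightarrow> frj.forces G X \<Gamma>"
    and "frj G (\<Gamma> \<Rightarrow>\<^sub>f X) \<Longrightarrow> \<not> frj.forces G X \<Gamma>"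
    and "\<lbrakk>frj G (\<Sigma> ;; \<Theta> \<rightarrow>\<^sub>f X); \<Sigma> \<subseteq> \<Gamma>; \<Gamma> \<subseteq> \<Sigma> \<union> \<Theta>\<rbrakk> \<Longrightarrow> \<not> frj.forces G X \<Gamma>"
  using assms
proof (induction X arbitrary: \<Gamma> \<Sigma> \<Theta>)
  case (Var p)
  have F: "Var p \<in> Vars_bot" by (simp add: Vars_bot_def Vars_def)
  { case 1 then show ?case by simp next
    case 2 then show ?case using frj_atom_notin(1)[OF F] by auto next
    case 3 then show ?case using frj_atom_notin(2)[OF F] by auto }
next
  case Bot
  { case 1 then show ?case using frj_world_subset_Gbar by fastforce next
    case 2 show ?case by simp next
    case 3 show ?case by simp }
next
  case (And A B)
  { case 1 then show ?case
      using And.IH(1,4) frj_world_subset_Gbar by (fastforce simp: Cl_And_iff) next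
    case 2
    from 2(1) show ?case
      by cases (use And.IH(2,5) 2 in \<open>auto simp: Vars_bot_def Vars_def\<close>) next
    case 3
    from 3(1) show ?case
      by cases (use And.IH(3,6) 3 in \<open>auto simp: Vars_bot_def Vars_def\<close>) }
next
  case (Or A B)
  { case 1 then show ?case
      using Or.IH(1,4) frj_world_subset_Gbar by (fastforce simp: Cl_Or_iff) next
    case 2 show ?case
      using frj_Or_reg_premises[OF 2(1)] Or.IH(3,6) 2(2) by (metis frj.forces.simps(4) insertCI) next
    case 3
    from 3(1) show ?case
    proof cases
      case (Or_irr \<Sigma>1 \<Theta>1 \<Sigma>2 \<Theta>2)
      have "\<Sigma>1 \<subseteq> \<Gamma>" "\<Gamma> \<subseteq> \<Sigma>1 \<union> \<Theta>1" "\<Sigma>2 \<subseteq> \<Gamma>" "\<Gamma> \<subseteq> \<Sigma>2 \<union> \<Theta>2"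
        using Or_irr 3 by auto
      then show ?thesis
        using Or.IH(3)[OF Or_irr(3)] Or.IH(6)[OF Or_irr(4)] 3(4) by simp
    qed (auto simp: Vars_bot_def Vars_def) }
next
  case (Imp A B)
  { case 1
    have "frj.forces G B \<Delta>" if \<Delta>: "\<Delta> \<in> frj_worlds G" "\<Gamma> \<subseteq> Cl \<Delta>" "frj.forces G A \<Delta>" for \<Delta>
    proof -
      have "A \<^bold>\<supset> B \<in> Cl \<Delta>" using 1(1) \<Delta>(2) Cl_least by blast
      \<comment> \<open>Otherwise an irregular refutation of \<open>A\<close> would apply at
        \<Delta>, although \<open>A\<close> is forced there. So the implication is in the closure
        because \<open>B\<close> is.\<close>
      moreover have "A \<^bold>\<supset> B \<notin> \<Delta>"
        using frj_antecedent_Imp Imp.IH(3) \<Delta> unfolding frj_worlds_def by blast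
      ultimately show ?thesis using Imp.IH(4) \<Delta>(1) by (simp add: Cl_Imp_iff)
    qed
    then show ?case by simp next
    case 2
    from 2(1) show ?case
    proof cases
      case Imp_in_reg
      then have "frj.forces G A \<Gamma>" "\<not> frj.forces G B \<Gamma>"
        using Imp.IH 2(2) by auto
      then show ?thesis using 2(2) frj.le_refl by auto
    qed (auto simp: Vars_bot_def Vars_def) next
    case 3
    from 3(1) show ?case
    proof cases
      case (Imp_in_irr \<Sigma>' \<Lambda>)
      have "A \<in> Cl \<Gamma>" using Imp_in_irr 3(2) Cl_mono by blast
      then have "frj.forces G A \<Gamma>" using Imp.IH(1) 3(4) by blast
      moreover have "\<not> frj.forces G B \<Gamma>"
        by (rule Imp.IH(6)[OF Imp_in_irr(2)]) (use Imp_in_irr(1) 3 in auto)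
      ultimately show ?thesis using 3(4) frj.le_refl by auto
    next
      case (Imp_notin \<Delta>)
      have \<Delta>: "\<Delta> \<in> frj_worlds G" using Imp_notin(2) by (auto simp: frj_worlds_def)
      \<comment> \<open>The antecedent \<Delta> of the premise is the later world that witnesses the
        failure of the implication at \<Gamma>.\<close>
      have "frj.forces G A \<Delta>" "\<not> frj.forces G B \<Delta>"
        using Imp.IH(1,5) Imp_notin \<Delta> by auto
      moreover have "\<Gamma> \<subseteq> Cl \<Delta>" using Imp_notin 3(3) by blast
      ultimately show ?thesis using \<Delta> by auto
    qed (auto simp: Vars_bot_def Vars_def) }
qed

lemma frj_not_gbu:
  assumes "frj_provable G"
  shows "\<not> gbu G ({} \<Rightarrow>\<^sub>g G)"
proof
  assume "gbu G ({} \<Rightarrow>\<^sub>g G)"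
  then have "frj.valid G ({} \<Rightarrow>\<^sub>g G)" by (rule frj.gbu_sound)
  moreover obtain \<Gamma> where "frj G (\<Gamma> \<Rightarrow>\<^sub>f G)"
    using assms by (auto simp: frj_provable_def)
  moreover from this have "\<Gamma> \<in> frj_worlds G" by (auto simp: frj_worlds_def)
  ultimately show False using frj_countermodel(2) by auto
qed

section \<open>Failed proof search yields refutations\<close>

definition refuted_reg :: "form \<Rightarrow> form set \<Rightarrow> form \<Rightarrow> bool" where
  "refuted_reg G \<Psi> C \<longleftrightarrow> (\<exists>\<Gamma>. frj G (\<Gamma> \<Rightarrow>\<^sub>f C) \<and> \<Psi> \<subseteq> Cl \<Gamma>)"

text \<open>\<Sigma> holds the formulas that the refutation requires, \<Theta> those that it
  tolerates.\<close>

definition refuted_irr :: "form \<Rightarrow> form set \<Rightarrow> form \<Rightarrow> bool" where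
  "refuted_irr G \<Psi> C \<longleftrightarrow> (\<exists>\<Sigma> \<Theta>. frj G (\<Sigma> ;; \<Theta> \<rightarrow>\<^sub>f C) \<and> \<Sigma> \<subseteq> \<Psi> \<and> \<Psi> \<subseteq> \<Sigma> \<union> \<Theta>)"

text \<open>Transitivity of the closure. It carries refutations back through the left rules of GBU,
  whose premises have the old antecedent in their closure.\<close>

lemma refuted_reg_Cl:
  assumes "refuted_reg G \<Psi> C" "\<Psi>' \<subseteq> Cl \<Psi>"
  shows "refuted_reg G \<Psi>' C"
  using assms unfolding refuted_reg_def by (meson Cl_least subset_iff)

text \<open>The irregular axiom requires nothing and tolerates all of \<open>Gbar G\<close> except
  \<open>F\<close>.\<close>

lemma refuted_irr_atom:
  assumes "F \<in> Vars_bot" "F \<in> Sr G" "\<Psi> \<subseteq> Gbar G" "F \<notin> \<Psi>"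
  shows "refuted_irr G \<Psi> F"
proof -
  have "frj G ({} ;; (Gbar_At G - {F}) \<union> Gbar_Imp G \<rightarrow>\<^sub>f F)"
    by (rule frj.Ax_irr) (use assms in \<open>auto simp: Gbar_def\<close>)
  then show ?thesis
    unfolding refuted_irr_def using assms by (fastforce simp: Gbar_def)
qed

lemma refuted_irr_And:
  assumes "refuted_irr G \<Psi> A" "A \<in> {A1, A2}" "A1 \<^bold>\<and> A2 \<in> Sr G"
  shows "refuted_irr G \<Psi> (A1 \<^bold>\<and> A2)"
proof -
  obtain \<Sigma> \<Theta> where *: "frj G (\<Sigma> ;; \<Theta> \<rightarrow>\<^sub>f A)" "\<Sigma> \<subseteq> \<Psi>" "\<Psi> \<subseteq> \<Sigma> \<union> \<Theta>"
    using assms(1) unfolding refuted_irr_def by blast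
  have "frj G (\<Sigma> ;; \<Theta> \<rightarrow>\<^sub>f A1 \<^bold>\<and> A2)"
    using frj_derivable_wf[OF *(1)] assms by (intro frj.And_irr[OF *(1)]) auto
  then show ?thesis using *(2,3) unfolding refuted_irr_def by blast
qed

text \<open>\<Psi> lies between \<Sigma> and \<open>\<Sigma> \<union> \<Theta>\<close> for both
  premises, which yields the side conditions of the rule, \<open>\<Sigma>1 \<subseteq> \<Psi>
  \<subseteq> \<Sigma>2 \<union> \<Theta>2\<close> and its mirror image.\<close>

lemma refuted_irr_Or:
  assumes "refuted_irr G \<Psi> C1" "refuted_irr G \<Psi> C2" "C1 \<^bold>\<or> C2 \<in> Sr G"
  shows "refuted_irr G \<Psi> (C1 \<^bold>\<or> C2)"
proof -
  obtain \<Sigma>1 \<Theta>1 \<Sigma>2 \<Theta>2 where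
    1: "frj G (\<Sigma>1 ;; \<Theta>1 \<rightarrow>\<^sub>f C1)" "\<Sigma>1 \<subseteq> \<Psi>" "\<Psi> \<subseteq> \<Sigma>1 \<union> \<Theta>1" and
    2: "frj G (\<Sigma>2 ;; \<Theta>2 \<rightarrow>\<^sub>f C2)" "\<Sigma>2 \<subseteq> \<Psi>" "\<Psi> \<subseteq> \<Sigma>2 \<union> \<Theta>2"
    using assms(1,2) unfolding refuted_irr_def by blast
  have "frj G (\<Sigma>1 \<union> \<Sigma>2 ;; \<Theta>1 \<inter> \<Theta>2 \<rightarrow>\<^sub>f C1 \<^bold>\<or> C2)"
    using frj_derivable_wf[OF 1(1)] frj_derivable_wf[OF 2(1)] 1 2 assms(3)
    by (intro frj.Or_irr) auto
  then show ?thesis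
    unfolding refuted_irr_def using 1 2 by blast
qed

text \<open>The rule wants a minimal \<Lambda>. It is sought among the subsets of
  \<open>\<Psi> \<inter> \<Theta>\<close>, so that \<open>\<Sigma> \<union> \<Lambda>\<close> stays
  inside \<Psi>; the whole of \<open>\<Psi> \<inter> \<Theta>\<close> is a candidate.\<close>

lemma refuted_irr_Imp_in:
  assumes "refuted_irr G \<Psi> B" "A \<in> Cl \<Psi>" "A \<^bold>\<supset> B \<in> Sr G"
  shows "refuted_irr G \<Psi> (A \<^bold>\<supset> B)"
proof -
  obtain \<Sigma> \<Theta> where *: "frj G (\<Sigma> ;; \<Theta> \<rightarrow>\<^sub>f B)" "\<Sigma> \<subseteq> \<Psi>" "\<Psi> \<subseteq> \<Sigma> \<union> \<Theta>"
    using assms(1) unfolding refuted_irr_def by blast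
  have wf: "\<Sigma> \<union> \<Theta> \<subseteq> Gbar G" using frj_derivable_wf[OF *(1)] by simp
  let ?S = "{\<Lambda>. \<Lambda> \<subseteq> \<Psi> \<inter> \<Theta> \<and> A \<in> Cl (\<Sigma> \<union> \<Lambda>)}"
  have "finite \<Theta>"
    using wf Gbar_subset_Sl finite_Sl by (meson finite_subset le_sup_iff)
  then have "finite ?S" by simp
  moreover have "\<Psi> \<inter> \<Theta> \<in> ?S"
    using assms(2) Cl_mono[of \<Psi> "\<Sigma> \<union> \<Psi> \<inter> \<Theta>"] * by blast
  ultimately obtain \<Lambda> where \<Lambda>: "\<Lambda> \<in> ?S" "\<And>\<Lambda>'. \<Lambda>' \<in> ?S \<Longrightarrow> \<Lambda>' \<subseteq> \<Lambda> \<Longrightarrow> \<Lambda>' = \<Lambda>"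
    using finite_has_minimal[of ?S] by (metis (no_types, lifting) empty_iff)
  have "(\<Theta> - \<Lambda>) \<union> \<Lambda> = \<Theta>" using \<Lambda> by blast
  moreover have "\<not> (\<exists>\<Lambda>'. \<Lambda>' \<subset> \<Lambda> \<and> A \<in> Cl (\<Sigma> \<union> \<Lambda>'))" using \<Lambda> by blast
  ultimately have "frj G (\<Sigma> \<union> \<Lambda> ;; \<Theta> - \<Lambda> \<rightarrow>\<^sub>f A \<^bold>\<supset> B)"
    using *(1) \<Lambda>(1) wf assms(3) by (intro frj.Imp_in_irr) auto
  then show ?thesis
    unfolding refuted_irr_def using * \<Lambda>(1) by blast
qed

text \<open>Dually, \<Theta> is a maximal extension of \<Psi> within
  \<open>Cl \<Gamma> \<inter> Gbar G\<close> whose closure omits \<open>A\<close>; \<Psi> itself is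
  a candidate.\<close>

lemma refuted_irr_Imp_notin:
  assumes "refuted_reg G (insert A \<Psi>) B" "A \<notin> Cl \<Psi>" "A \<^bold>\<supset> B \<in> Sr G" "\<Psi> \<subseteq> Gbar G"
  shows "refuted_irr G \<Psi> (A \<^bold>\<supset> B)"
proof -
  obtain \<Gamma> where \<Gamma>: "frj G (\<Gamma> \<Rightarrow>\<^sub>f B)" "insert A \<Psi> \<subseteq> Cl \<Gamma>"
    using assms(1) unfolding refuted_reg_def by blast
  let ?S = "{\<Theta>. \<Psi> \<subseteq> \<Theta> \<and> \<Theta> \<subseteq> Cl \<Gamma> \<inter> Gbar G \<and> A \<notin> Cl \<Theta>}"
  have "finite (Gbar G)"
    using Gbar_subset_Sl finite_Sl finite_subset by blast
  then have "finite ?S"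
    by (rule finite_subset[OF _ finite_Pow_iff[THEN iffD2], rotated]) auto
  moreover have "\<Psi> \<in> ?S" using \<Gamma> assms by auto
  ultimately obtain \<Theta> where \<Theta>: "\<Theta> \<in> ?S" "\<And>\<Theta>'. \<Theta>' \<in> ?S \<Longrightarrow> \<Theta> \<subseteq> \<Theta>' \<Longrightarrow> \<Theta>' = \<Theta>"
    using finite_has_maximal[of ?S] by (metis (no_types, lifting) empty_iff)
  have "A \<in> Cl \<Theta>'" if "\<Theta> \<subset> \<Theta>' \<and> \<Theta>' \<subseteq> Cl \<Gamma> \<inter> Gbar G" for \<Theta>'
    using \<Theta>(1) \<Theta>(2)[of \<Theta>'] that by blast
  then have "frj G ({} ;; \<Theta> \<rightarrow>\<^sub>f A \<^bold>\<supset> B)"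
    using \<Gamma> \<Theta>(1) assms(3) by (intro frj.Imp_notin[OF \<Gamma>(1)]) auto
  then show ?thesis
    unfolding refuted_irr_def using \<Theta>(1) by blast
qed

lemma refuted_reg_And:
  assumes "refuted_reg G \<Psi> A" "A \<in> {A1, A2}" "A1 \<^bold>\<and> A2 \<in> Sr G"
  shows "refuted_reg G \<Psi> (A1 \<^bold>\<and> A2)"
proof -
  obtain \<Gamma> where \<Gamma>: "frj G (\<Gamma> \<Rightarrow>\<^sub>f A)" "\<Psi> \<subseteq> Cl \<Gamma>"
    using assms(1) unfolding refuted_reg_def by blast
  have "frj G (\<Gamma> \<Rightarrow>\<^sub>f A1 \<^bold>\<and> A2)"
    using frj_derivable_wf[OF \<Gamma>(1)] assms by (intro frj.And_reg[OF \<Gamma>(1)]) auto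
  then show ?thesis using \<Gamma>(2) unfolding refuted_reg_def by blast
qed

lemma refuted_reg_Imp:
  assumes "refuted_reg G \<Psi> B" "A \<in> Cl \<Psi>" "A \<^bold>\<supset> B \<in> Sr G"
  shows "refuted_reg G \<Psi> (A \<^bold>\<supset> B)"
proof -
  obtain \<Gamma> where \<Gamma>: "frj G (\<Gamma> \<Rightarrow>\<^sub>f B)" "\<Psi> \<subseteq> Cl \<Gamma>"
    using assms(1) unfolding refuted_reg_def by blast
  have "frj G (\<Gamma> \<Rightarrow>\<^sub>f A \<^bold>\<supset> B)"
    using frj_derivable_wf[OF \<Gamma>(1)] Cl_least[OF assms(2) \<Gamma>(2)] assms(3)
    by (intro frj.Imp_in_reg[OF \<Gamma>(1)]) auto
  then show ?thesis using \<Gamma>(2) unfolding refuted_reg_def by blast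
qed

section \<open>Joining refutations\<close>

text \<open>All premises enclose the same \<Psi>, so they are compatible. A formula of \<Psi>
  outside every \<Sigma> lies in every \<Theta>, and the join keeps it: it is a variable other than
  \<open>F\<close> or an implication with antecedent in \<open>U\<close>.\<close>

lemma refuted_irr_family:
  assumes "finite U" "U \<noteq> {}" "\<And>Y. Y \<in> U \<Longrightarrow> refuted_irr G \<Psi> Y"
    and "\<And>Y Z. Y \<^bold>\<supset> Z \<in> \<Psi> \<Longrightarrow> Y \<in> U" "\<Psi> \<subseteq> Gbar G" "F \<notin> \<Psi>"
  obtains n \<Sigma> \<Theta> A \<Gamma> where "joinable n \<Sigma> \<Theta> A" "join_rhs n A = U"
    "\<And>j. j \<in> {1..n} \<Longrightarrow> frj G (\<Sigma> j ;; \<Theta> j \<rightarrow>\<^sub>f A j)"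
    "F \<notin> join_Sig_At n \<Sigma>"
    "\<Gamma> = join_Sig_At n \<Sigma> \<union> (join_Th_At n \<Theta> - {F}) \<union> join_Sig_Imp n \<Sigma> \<union> join_Th_Imp n \<Theta> A"
    "\<Gamma> \<subseteq> Gbar G" "\<Psi> \<subseteq> \<Gamma>"
proof -
  obtain n and A :: "nat \<Rightarrow> form" where A: "A ` {1..n} = U"
    using ex_bij_betw_nat_finite_1[OF assms(1)] bij_betw_imp_surj_on by blast
  then have n: "1 \<le> n" using assms(2) by (cases n) auto
  have "\<forall>j. \<exists>\<Sigma> \<Theta>. j \<in> {1..n} \<longrightarrow> frj G (\<Sigma> ;; \<Theta> \<rightarrow>\<^sub>f A j) \<and> \<Sigma> \<subseteq> \<Psi> \<and> \<Psi> \<subseteq> \<Sigma> \<union> \<Theta>"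
    using assms(3) A unfolding refuted_irr_def by blast
  then obtain \<Sigma> \<Theta> where
    *: "\<And>j. j \<in> {1..n} \<Longrightarrow> frj G (\<Sigma> j ;; \<Theta> j \<rightarrow>\<^sub>f A j) \<and> \<Sigma> j \<subseteq> \<Psi> \<and> \<Psi> \<subseteq> \<Sigma> j \<union> \<Theta> j"
    by metis
  have U: "join_rhs n A = U" using A by (simp add: join_rhs_def)
  have join: "joinable n \<Sigma> \<Theta> A"
    unfolding joinable_def U join_Sig_Imp_def using n * assms(4) by blast
  have F: "F \<notin> join_Sig_At n \<Sigma>"
    unfolding join_Sig_At_def using * assms(6) by blast
  define \<Gamma> where
    "\<Gamma> = join_Sig_At n \<Sigma> \<union> (join_Th_At n \<Theta> - {F}) \<union> join_Sig_Imp n \<Sigma> \<union> join_Th_Imp n \<Theta> A"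
  have wf: "\<And>j. j \<in> {1..n} \<Longrightarrow> \<Sigma> j \<union> \<Theta> j \<subseteq> Gbar G"
    using * frj_derivable_wf by fastforce
  have "\<Gamma> \<subseteq> Gbar G"
    using join_between[OF wf join F \<Gamma>_def, of 1] wf[of 1] n by auto
  moreover have "\<Psi> \<subseteq> \<Gamma>"
  proof
    fix X assume X: "X \<in> \<Psi>"
    show "X \<in> \<Gamma>"
    proof (cases "\<exists>j\<in>{1..n}. X \<in> \<Sigma> j")
      case True
      then show ?thesis using join_between[OF wf join F \<Gamma>_def] by blast
    next
      case False
      then have "X \<in> (\<Inter>j\<in>{1..n}. \<Theta> j)" using * X by blast
      moreover have "X \<in> Vars \<or> (\<exists>Y Z. X = Y \<^bold>\<supset> Z)"
        using X assms(5) Gbar_Un[of G] by (auto simp: Imps_def)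
      ultimately show ?thesis
        using X assms(4,6) unfolding \<Gamma>_def join_Th_At_def join_Th_Imp_def U
        by (auto simp: Imps_def)
    qed
  qed
  ultimately show ?thesis
    using that[OF join U _ F \<Gamma>_def] * by blast
qed

text \<open>A join needs at least one premise, so the axiom handles a \<Psi> without implications.
  Otherwise the premises refute the antecedents of the implications in \<Psi>.\<close>

lemma refuted_reg_atom:
  assumes F: "F \<in> Vars_bot" "F \<in> Sr G" "F \<notin> \<Psi>" and \<Psi>: "\<Psi> \<subseteq> Gbar G"
    and Imps: "\<And>Y Z. Y \<^bold>\<supset> Z \<in> \<Psi> \<Longrightarrow> refuted_irr G \<Psi> Y"
  shows "refuted_reg G \<Psi> F"
proof (cases "\<exists>Y Z. Y \<^bold>\<supset> Z \<in> \<Psi>")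
  case False
  have "frj G (Gbar_At G - {F} \<Rightarrow>\<^sub>f F)"
    by (rule frj.Ax_reg) (use F in \<open>auto simp: Gbar_def\<close>)
  moreover have "\<Psi> \<subseteq> Gbar_At G - {F}"
    using \<Psi> F False by (auto simp: Gbar_def Gbar_Imp_def Imps_def)
  ultimately show ?thesis unfolding refuted_reg_def by (blast intro: Cl_base)
next
  case True
  define U where "U = {Y. \<exists>Z. Y \<^bold>\<supset> Z \<in> \<Psi>}"
  \<comment> \<open>\<open>U\<close> is finite as part of an image of \<Psi>; the value at formulas
    other than implications is arbitrary.\<close>
  have "U \<subseteq> (\<lambda>X. case X of Y \<^bold>\<supset> Z \<Rightarrow> Y | _ \<Rightarrow> X) ` \<Psi>"
    unfolding U_def by force
  moreover have "finite \<Psi>"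
    using \<Psi> Gbar_subset_Sl finite_Sl by (meson finite_subset)
  ultimately have "finite U" by (meson finite_imageI finite_subset)
  moreover have "U \<noteq> {}" using True by (auto simp: U_def)
  ultimately obtain n \<Sigma> \<Theta> A \<Gamma> where *: "joinable n \<Sigma> \<Theta> A" "join_rhs n A = U"
    "\<And>j. j \<in> {1..n} \<Longrightarrow> frj G (\<Sigma> j ;; \<Theta> j \<rightarrow>\<^sub>f A j)" "F \<notin> join_Sig_At n \<Sigma>"
    "\<Gamma> = join_Sig_At n \<Sigma> \<union> (join_Th_At n \<Theta> - {F}) \<union> join_Sig_Imp n \<Sigma> \<union> join_Th_Imp n \<Theta> A"
    "\<Gamma> \<subseteq> Gbar G" "\<Psi> \<subseteq> \<Gamma>"
    by (rule refuted_irr_family[of U G \<Psi> F]) (use Imps \<Psi> F in \<open>auto simp: U_def\<close>)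
  have "frj G (\<Gamma> \<Rightarrow>\<^sub>f F)"
    by (rule frj.Join_At[OF *(3,1) _ _ *(5)])
      (use *(2,4,6) F \<Psi> Gbar_subset_Sl[of G] in \<open>auto simp: U_def\<close>)
  then show ?thesis
    unfolding refuted_reg_def using *(7) by (blast intro: Cl_base)
qed

text \<open>Here the family also contains the two disjuncts, so it is nonempty even if \<Psi> has no
  implications.\<close>

lemma refuted_reg_Or:
  assumes C: "C1 \<^bold>\<or> C2 \<in> Sr G" "refuted_irr G \<Psi> C1" "refuted_irr G \<Psi> C2" and \<Psi>: "\<Psi> \<subseteq> Gbar G"
    and Imps: "\<And>Y Z. Y \<^bold>\<supset> Z \<in> \<Psi> \<Longrightarrow> refuted_irr G \<Psi> Y"
  shows "refuted_reg G \<Psi> (C1 \<^bold>\<or> C2)"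
proof -
  define U where "U = {C1, C2} \<union> {Y. \<exists>Z. Y \<^bold>\<supset> Z \<in> \<Psi>}"
  have "U \<subseteq> {C1, C2} \<union> (\<lambda>X. case X of Y \<^bold>\<supset> Z \<Rightarrow> Y | _ \<Rightarrow> X) ` \<Psi>"
    unfolding U_def by force
  moreover have "finite \<Psi>"
    using \<Psi> Gbar_subset_Sl finite_Sl by (meson finite_subset)
  ultimately have "finite U"
    by (meson finite_imageI finite_subset finite.emptyI finite.insertI finite_UnI)
  moreover have "U \<noteq> {}" by (auto simp: U_def)
  moreover have "\<^bold>\<bottom> \<notin> \<Psi>" using \<Psi> by auto
  moreover have "refuted_irr G \<Psi> Y" if "Y \<in> U" for Y
    using that C Imps by (auto simp: U_def)
  moreover have "Y \<in> U" if "Y \<^bold>\<supset> Z \<in> \<Psi>" for Y Z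
    using that by (auto simp: U_def)
  ultimately obtain n \<Sigma> \<Theta> A \<Gamma> where *: "joinable n \<Sigma> \<Theta> A" "join_rhs n A = U"
    "\<And>j. j \<in> {1..n} \<Longrightarrow> frj G (\<Sigma> j ;; \<Theta> j \<rightarrow>\<^sub>f A j)" "\<^bold>\<bottom> \<notin> join_Sig_At n \<Sigma>"
    "\<Gamma> = join_Sig_At n \<Sigma> \<union> (join_Th_At n \<Theta> - {\<^bold>\<bottom>}) \<union> join_Sig_Imp n \<Sigma> \<union> join_Th_Imp n \<Theta> A"
    "\<Gamma> \<subseteq> Gbar G" "\<Psi> \<subseteq> \<Gamma>"
    using \<Psi> by (rule_tac refuted_irr_family[of U G \<Psi> "\<^bold>\<bottom>"]) blast+
  have n: "1 \<le> n" using *(1) by (simp add: joinable_def)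
  have "frj G (\<Gamma> \<Rightarrow>\<^sub>f C1 \<^bold>\<or> C2)"
    by (rule frj.Join_Or[OF *(3,1) _ _ *(5)[unfolded join_Th_At_Bot[OF n]]])
      (use *(2,6) C \<Psi> Gbar_subset_Sl[of G] in \<open>auto simp: U_def\<close>)
  then show ?thesis
    unfolding refuted_reg_def using *(7) by (blast intro: Cl_base)
qed

section \<open>The termination order of proof search\<close>

fun antecedent :: "gbu_sequent \<Rightarrow> form set" where
  "antecedent (\<Psi> \<Rightarrow>\<^sub>g C) = \<Psi>"
| "antecedent (\<Psi> \<rightarrow>\<^sub>g C) = \<Psi>"

fun regular_rank :: "gbu_sequent \<Rightarrow> nat" where
  "regular_rank (\<Psi> \<Rightarrow>\<^sub>g C) = 1"
| "regular_rank (\<Psi> \<rightarrow>\<^sub>g C) = 0"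

fun weight :: "gbu_sequent \<Rightarrow> nat" where
  "weight (\<Psi> \<Rightarrow>\<^sub>g C) = sum size \<Psi> + size C"
| "weight (\<Psi> \<rightarrow>\<^sub>g C) = sum size \<Psi> + size C"

text \<open>The first component drops when a formula enters the closure, which pays for returning
  from an irregular to a regular sequent; the second drops on the way to irregular sequents, the
  third when formulas get simpler.\<close>

definition search_less :: "form \<Rightarrow> (gbu_sequent \<times> gbu_sequent) set" where
  "search_less G = measures [\<lambda>s. card (Sl G - Cl (antecedent s)), regular_rank, weight]"

lemma wf_search_less: "wf (search_less G)"
  by (simp add: search_less_def)

lemma search_less_closure:
  assumes "antecedent s \<subseteq> Cl (antecedent s')" "A \<in> antecedent s'" "A \<in> Sl G" "A \<notin> Cl (antecedent s)"
  shows "(s', s) \<in> search_less G"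
proof -
  have "Cl (antecedent s) \<subseteq> Cl (antecedent s')"
    using assms(1) Cl_least by blast
  then have "Sl G - Cl (antecedent s') \<subset> Sl G - Cl (antecedent s)"
    using assms(2-4) Cl_base by blast
  then show ?thesis
    using finite_Sl by (simp add: search_less_def psubset_card_mono)
qed

lemma search_less_weight:
  assumes "antecedent s \<subseteq> Cl (antecedent s')" "regular_rank s' \<le> regular_rank s"
    and "regular_rank s' < regular_rank s \<or> weight s' < weight s"
  shows "(s', s) \<in> search_less G"
proof -
  have "Cl (antecedent s) \<subseteq> Cl (antecedent s')"
    using assms(1) Cl_least by blast
  then have "card (Sl G - Cl (antecedent s')) \<le> card (Sl G - Cl (antecedent s))"
    using finite_Sl by (intro card_mono) auto
  then show ?thesis
    using assms(2,3) by (auto simp: search_less_def)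
qed

text \<open>Equality can fail because \<open>A\<close> may already be in \<Psi>. For infinite \<Psi>
  both sums are 0.\<close>

lemma sum_size_insert_le: "sum size (insert A \<Psi>) \<le> size A + sum size (\<Psi> :: form set)"
proof (cases "finite \<Psi>")
  case True
  then show ?thesis by (cases "A \<in> \<Psi>") (auto simp: insert_absorb)
qed simp

lemma sum_size_replace:
  assumes "finite (\<Psi> :: form set)" "X \<in> \<Psi>"
  shows "size A < size X \<Longrightarrow> sum size (insert A (\<Psi> - {X})) < sum size \<Psi>"
    and "size A + size B < size X \<Longrightarrow> sum size (insert A (insert B (\<Psi> - {X}))) < sum size \<Psi>"
proof -
  have "sum size \<Psi> = size X + sum size (\<Psi> - {X})"
    using assms by (rule sum.remove)
  then show "size A < size X \<Longrightarrow> sum size (insert A (\<Psi> - {X})) < sum size \<Psi>"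
    and "size A + size B < size X \<Longrightarrow> sum size (insert A (insert B (\<Psi> - {X}))) < sum size \<Psi>"
    using sum_size_insert_le[of A "\<Psi> - {X}"] sum_size_insert_le[of B "\<Psi> - {X}"]
      sum_size_insert_le[of A "insert B (\<Psi> - {X})"] by linarith+
qed

section \<open>Proof search\<close>

text \<open>Irregular sequents of FRJ contain only variables and implications on the left; the
  search passes to irregular sequents only once the antecedent has this form.\<close>

fun refuted :: "form \<Rightarrow> gbu_sequent \<Rightarrow> bool" where
  "refuted G (\<Psi> \<Rightarrow>\<^sub>g C) \<longleftrightarrow> refuted_reg G \<Psi> C"
| "refuted G (\<Psi> \<rightarrow>\<^sub>g C) \<longleftrightarrow> (\<Psi> \<subseteq> Gbar G \<longrightarrow> refuted_irr G \<Psi> C)"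

lemma search_irr:
  assumes IH: "\<And>s'. (s', \<Psi> \<rightarrow>\<^sub>g C) \<in> search_less G \<Longrightarrow> gbu_wf G s' \<Longrightarrow> gbu G s' \<or> refuted G s'"
    and wf: "\<Psi> \<subseteq> Sl G" "C \<in> Sr G" and \<Psi>: "\<Psi> \<subseteq> Gbar G"
  shows "gbu G (\<Psi> \<rightarrow>\<^sub>g C) \<or> refuted_irr G \<Psi> C"
proof -
  have smaller: "gbu G (\<Psi> \<rightarrow>\<^sub>g A) \<or> refuted_irr G \<Psi> A" if "A \<in> Sr G" "size A < size C" for A
  proof -
    have "(\<Psi> \<rightarrow>\<^sub>g A, \<Psi> \<rightarrow>\<^sub>g C) \<in> search_less G"
      using that by (intro search_less_weight) (auto intro: Cl_base)
    then show ?thesis using IH[of "\<Psi> \<rightarrow>\<^sub>g A"] that wf \<Psi> by auto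
  qed
  have atom: ?thesis if "C \<in> Vars_bot"
  proof (cases "C \<in> \<Psi>")
    case True
    then show ?thesis using gbu.Ax_irr[of G C \<Psi>] wf by (auto simp: insert_absorb)
  next
    case False
    then show ?thesis using refuted_irr_atom that wf \<Psi> by blast
  qed
  show ?thesis
  proof (cases C)
    case (Var p)
    then show ?thesis using atom by (simp add: Vars_bot_def Vars_def)
  next
    case Bot
    then show ?thesis using atom by (simp add: Vars_bot_def)
  next
    case (And A B)
    then have "A \<in> Sr G" "B \<in> Sr G" using wf Sr_And1 Sr_And2 by blast+
    then show ?thesis
      using smaller[of A] smaller[of B] gbu.R_And_irr[of G \<Psi> A B]
        refuted_irr_And[of G \<Psi> A A B] refuted_irr_And[of G \<Psi> B A B] wf And by auto
  next
    case (Or A B)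
    then have "A \<in> Sr G" "B \<in> Sr G" using wf Sr_Or1 Sr_Or2 by blast+
    then show ?thesis
      using smaller[of A] smaller[of B] gbu.R_Or_irr[of G \<Psi> A A B] gbu.R_Or_irr[of G \<Psi> B A B]
        refuted_irr_Or[of G \<Psi> A B] wf Or by auto
  next
    case (Imp A B)
    then have AB: "A \<in> Sl G" "B \<in> Sr G" using wf Sr_Imp1 Sr_Imp2 by blast+
    show ?thesis
    proof (cases "A \<in> Cl \<Psi>")
      case True
      then show ?thesis
        using smaller[of B] gbu.R_Imp_in_irr[of G \<Psi> B A] refuted_irr_Imp_in[of G \<Psi> B A] wf Imp AB
        by auto
    next
      case False
      \<comment> \<open>The sequent becomes regular again, but \<open>A\<close> is new in the
        closure.\<close>
      then have "(insert A \<Psi> \<Rightarrow>\<^sub>g B, \<Psi> \<rightarrow>\<^sub>g C) \<in> search_less G"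
        using AB by (intro search_less_closure[of _ _ A]) (auto intro: Cl_base)
      then have "gbu G (insert A \<Psi> \<Rightarrow>\<^sub>g B) \<or> refuted_reg G (insert A \<Psi>) B"
        using IH[of "insert A \<Psi> \<Rightarrow>\<^sub>g B"] AB wf by auto
      then show ?thesis
        using gbu.R_Imp_notin_irr[of G A \<Psi> B] refuted_irr_Imp_notin[of G A \<Psi> B] False wf \<Psi> Imp
        by auto
    qed
  qed
qed

text \<open>\<open>Imps\<close> says that every implication on the left fails at its minor premise.
  These refutations, with those of the disjuncts if \<open>C\<close> is a disjunction, feed the
  join.\<close>

lemma search_reg_right:
  assumes IH: "\<And>s'. (s', \<Psi> \<Rightarrow>\<^sub>g C) \<in> search_less G \<Longrightarrow> gbu_wf G s' \<Longrightarrow> gbu G s' \<or> refuted G s'"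
    and wf: "\<Psi> \<subseteq> Sl G" "C \<in> Sr G" and \<Psi>: "\<Psi> \<subseteq> Gbar G"
    and Imps: "\<And>Y Z. Y \<^bold>\<supset> Z \<in> \<Psi> \<Longrightarrow> refuted_irr G \<Psi> Y"
  shows "gbu G (\<Psi> \<Rightarrow>\<^sub>g C) \<or> refuted_reg G \<Psi> C"
proof -
  have smaller: "gbu G (\<Psi> \<Rightarrow>\<^sub>g A) \<or> refuted_reg G \<Psi> A" if "A \<in> Sr G" "size A < size C" for A
  proof -
    have "(\<Psi> \<Rightarrow>\<^sub>g A, \<Psi> \<Rightarrow>\<^sub>g C) \<in> search_less G"
      using that by (intro search_less_weight) (auto intro: Cl_base)
    then show ?thesis using IH[of "\<Psi> \<Rightarrow>\<^sub>g A"] that wf \<Psi> by auto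
  qed
  have irr: "gbu G (\<Psi> \<rightarrow>\<^sub>g A) \<or> refuted_irr G \<Psi> A" if "A \<in> Sr G" for A
  proof -
    have "(\<Psi> \<rightarrow>\<^sub>g A, \<Psi> \<Rightarrow>\<^sub>g C) \<in> search_less G"
      by (rule search_less_weight) (auto intro: Cl_base)
    then show ?thesis using IH[of "\<Psi> \<rightarrow>\<^sub>g A"] that wf \<Psi> by auto
  qed
  have atom: ?thesis if "C \<in> Vars_bot"
  proof (cases "C \<in> \<Psi>")
    case True
    then show ?thesis using gbu.Ax_reg[of G C \<Psi>] wf by (auto simp: insert_absorb)
  next
    case False
    then show ?thesis using refuted_reg_atom[OF that wf(2) _ \<Psi>] Imps by blast
  qed
  show ?thesis
  proof (cases C)
    case (Var p)
    then show ?thesis using atom by (simp add: Vars_bot_def Vars_def)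
  next
    case Bot
    then show ?thesis using atom by (simp add: Vars_bot_def)
  next
    case (And A B)
    then have "A \<in> Sr G" "B \<in> Sr G" using wf Sr_And1 Sr_And2 by blast+
    then show ?thesis
      using smaller[of A] smaller[of B] gbu.R_And_reg[of G \<Psi> A B]
        refuted_reg_And[of G \<Psi> A A B] refuted_reg_And[of G \<Psi> B A B] wf And by auto
  next
    case (Or A B)
    then have "A \<in> Sr G" "B \<in> Sr G" using wf Sr_Or1 Sr_Or2 by blast+
    moreover have "refuted_reg G \<Psi> C" if "refuted_irr G \<Psi> A" "refuted_irr G \<Psi> B"
      using refuted_reg_Or[OF _ that \<Psi>] Imps wf Or by blast
    ultimately show ?thesis
      using irr[of A] irr[of B] gbu.R_Or_reg[of G \<Psi> A A B] gbu.R_Or_reg[of G \<Psi> B A B] wf Or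
      by auto
  next
    case (Imp A B)
    then have AB: "A \<in> Sl G" "B \<in> Sr G" using wf Sr_Imp1 Sr_Imp2 by blast+
    show ?thesis
    proof (cases "A \<in> Cl \<Psi>")
      case True
      then show ?thesis
        using smaller[of B] gbu.R_Imp_in_reg[of G \<Psi> B A] refuted_reg_Imp[of G \<Psi> B A] wf Imp AB
        by auto
    next
      case False
      then have "(insert A \<Psi> \<Rightarrow>\<^sub>g B, \<Psi> \<Rightarrow>\<^sub>g C) \<in> search_less G"
        using AB by (intro search_less_closure[of _ _ A]) (auto intro: Cl_base)
      then consider "gbu G (insert A \<Psi> \<Rightarrow>\<^sub>g B)" | "refuted_reg G (insert A \<Psi>) B"
        using IH[of "insert A \<Psi> \<Rightarrow>\<^sub>g B"] AB wf by auto
      then show ?thesis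
      proof cases
        case 1
        then show ?thesis using gbu.R_Imp_notin_reg False wf Imp by simp
      next
        case 2
        \<comment> \<open>The FRJ rule needs \<open>A\<close> in the closure of the antecedent, so
          it is applied with \<open>A\<close> added, and then \<open>A\<close> is dropped.\<close>
        have "refuted_reg G (insert A \<Psi>) C"
          unfolding Imp using 2 wf(2) Imp by (intro refuted_reg_Imp) (auto intro: Cl_base)
        then have "refuted_reg G \<Psi> C"
          by (rule refuted_reg_Cl) (auto intro: Cl_base)
        then show ?thesis ..
      qed
    qed
  qed
qed

text \<open>Left rules come first. An implication whose minor premise is derivable reduces the goal
  to its major premise; if there is none, all minor premises are refuted and the right formula is
  analysed.\<close>

lemma search_reg:
  assumes IH: "\<And>s'. (s', \<Psi> \<Rightarrow>\<^sub>g C) \<in> search_less G \<Longrightarrow> gbu_wf G s' \<Longrightarrow> gbu G s' \<or> refuted G s'"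
    and wf: "\<Psi> \<subseteq> Sl G" "C \<in> Sr G"
  shows "gbu G (\<Psi> \<Rightarrow>\<^sub>g C) \<or> refuted_reg G \<Psi> C"
proof -
  have fin: "finite \<Psi>" using wf finite_Sl finite_subset by blast
  have wf': "gbu_wf G (\<Psi> \<Rightarrow>\<^sub>g C)" using wf by simp
  have left: "gbu G (\<Delta> \<Rightarrow>\<^sub>g C) \<or> refuted_reg G \<Psi> C"
    if "\<Delta> \<subseteq> Sl G" "sum size \<Delta> < sum size \<Psi>" "\<Psi> \<subseteq> Cl \<Delta>" for \<Delta>
  proof -
    have "(\<Delta> \<Rightarrow>\<^sub>g C, \<Psi> \<Rightarrow>\<^sub>g C) \<in> search_less G"
      using that by (intro search_less_weight) auto
    then show ?thesis using IH[of "\<Delta> \<Rightarrow>\<^sub>g C"] that wf refuted_reg_Cl[OF _ that(3)] by auto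
  qed
  consider (bot) "\<^bold>\<bottom> \<in> \<Psi>" | (conj) A B where "A \<^bold>\<and> B \<in> \<Psi>" | (disj) A B where "A \<^bold>\<or> B \<in> \<Psi>"
    | (gbar) "\<Psi> \<subseteq> Gbar G"
  proof -
    have "X \<in> Gbar G \<or> X = \<^bold>\<bottom> \<or> (\<exists>A B. X = A \<^bold>\<and> B \<or> X = A \<^bold>\<or> B)" if "X \<in> \<Psi>" for X
      using that wf
      by (cases X) (auto simp: Gbar_def Gbar_At_def Gbar_Imp_def Vars_def Imps_def)
    then show ?thesis using that by blast
  qed
  then show ?thesis
  proof cases
    case bot
    then show ?thesis using gbu.Ax_bot[of G \<Psi> C] wf' by (simp add: insert_absorb)
  next
    case (conj A B)
    define \<Delta> where "\<Delta> = \<Psi> - {A \<^bold>\<and> B}"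
    have \<Psi>: "\<Psi> = insert (A \<^bold>\<and> B) \<Delta>" using conj by (auto simp: \<Delta>_def)
    have "gbu G (insert A (insert B \<Delta>) \<Rightarrow>\<^sub>g C) \<or> refuted_reg G \<Psi> C"
    proof (rule left)
      show "insert A (insert B \<Delta>) \<subseteq> Sl G"
        using wf conj by (auto simp: \<Delta>_def intro: Sl_And1 Sl_And2)
      show "sum size (insert A (insert B \<Delta>)) < sum size \<Psi>"
        unfolding \<Delta>_def using fin conj by (rule sum_size_replace) simp
      show "\<Psi> \<subseteq> Cl (insert A (insert B \<Delta>))" unfolding \<Psi> by (auto intro: Cl.intros)
    qed
    then show ?thesis using gbu.L_And[of G A B \<Delta> C] wf' \<Psi> by auto
  next
    case (disj A B)
    define \<Delta> where "\<Delta> = \<Psi> - {A \<^bold>\<or> B}"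
    have \<Psi>: "\<Psi> = insert (A \<^bold>\<or> B) \<Delta>" using disj by (auto simp: \<Delta>_def)
    have "gbu G (insert X \<Delta> \<Rightarrow>\<^sub>g C) \<or> refuted_reg G \<Psi> C" if "X \<in> {A, B}" for X
    proof (rule left)
      show "insert X \<Delta> \<subseteq> Sl G"
        using wf disj that by (auto simp: \<Delta>_def intro: Sl_Or1 Sl_Or2)
      show "sum size (insert X \<Delta>) < sum size \<Psi>"
        unfolding \<Delta>_def using fin disj by (rule sum_size_replace) (use that in auto)
      show "\<Psi> \<subseteq> Cl (insert X \<Delta>)" unfolding \<Psi> using that by (auto intro: Cl.intros)
    qed
    then show ?thesis using gbu.L_Or[of G A \<Delta> C B] wf' \<Psi> by auto
  next
    case gbar
    have major: "gbu G (insert B (\<Psi> - {A \<^bold>\<supset> B}) \<Rightarrow>\<^sub>g C) \<or> refuted_reg G \<Psi> C"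
      if "A \<^bold>\<supset> B \<in> \<Psi>" for A B
    proof (rule left)
      show "insert B (\<Psi> - {A \<^bold>\<supset> B}) \<subseteq> Sl G"
        using wf that by (auto intro: Sl_Imp2)
      show "sum size (insert B (\<Psi> - {A \<^bold>\<supset> B})) < sum size \<Psi>"
        using fin that by (rule sum_size_replace) simp
      \<comment> \<open>\<open>B\<close> alone restores the implication in the closure, so a
        refutation of the major premise refutes the conclusion.\<close>
      have "A \<^bold>\<supset> B \<in> Cl (insert B (\<Psi> - {A \<^bold>\<supset> B}))"
        by (simp add: Cl_base Cl_Imp)
      then show "\<Psi> \<subseteq> Cl (insert B (\<Psi> - {A \<^bold>\<supset> B}))"
        by (auto intro: Cl_base)
    qed
    have minor: "gbu G (\<Psi> \<rightarrow>\<^sub>g A) \<or> refuted_irr G \<Psi> A" if "A \<^bold>\<supset> B \<in> \<Psi>" for A B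
    proof -
      have "A \<in> Sr G" using wf that Sl_Imp1 by blast
      moreover have "(\<Psi> \<rightarrow>\<^sub>g A, \<Psi> \<Rightarrow>\<^sub>g C) \<in> search_less G"
        by (rule search_less_weight) (auto intro: Cl_base)
      ultimately show ?thesis using IH[of "\<Psi> \<rightarrow>\<^sub>g A"] wf gbar by auto
    qed
    have "gbu G (\<Psi> \<Rightarrow>\<^sub>g C) \<or> refuted_reg G \<Psi> C"
      if "A \<^bold>\<supset> B \<in> \<Psi>" "gbu G (\<Psi> \<rightarrow>\<^sub>g A)" for A B
    proof -
      \<comment> \<open>With this context the minor premise has antecedent \<Psi>, while the major
        premise loses the implication and gets lighter.\<close>
      have "insert (A \<^bold>\<supset> B) (\<Psi> - {A \<^bold>\<supset> B}) = \<Psi>" using that by blast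
      then show ?thesis
        using gbu.L_Imp[of G A B "\<Psi> - {A \<^bold>\<supset> B}" C] major[OF that(1)] that(2) wf' by auto
    qed
    then show ?thesis
      using search_reg_right[OF IH wf gbar] minor by metis
  qed
qed

lemma gbu_or_refuted: "gbu_wf G s \<Longrightarrow> gbu G s \<or> refuted G s"
proof (induction s rule: wf_induct_rule[OF wf_search_less[of G]])
  case (1 s)
  show ?case
  proof (cases s)
    case (GReg \<Psi> C)
    then show ?thesis using search_reg[of \<Psi> C G] 1 by auto
  next
    case (GIrr \<Psi> C)
    then show ?thesis using search_irr[of \<Psi> C G] 1 by auto
  qed
qed

theorem theorem5p11:
  fixes G :: form
  shows "gbu G ({} \<Rightarrow>\<^sub>g G) \<longleftrightarrow> \<not> frj_provable G"
proof
  show "\<not> frj_provable G" if "gbu G ({} \<Rightarrow>\<^sub>g G)"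
    using that frj_not_gbu by blast
  show "gbu G ({} \<Rightarrow>\<^sub>g G)" if "\<not> frj_provable G"
    \<comment> \<open>With an empty antecedent, refutability is FRJ provability.\<close>
    using gbu_or_refuted[of G "{} \<Rightarrow>\<^sub>g G"] that Sr_refl
    by (auto simp: frj_provable_def refuted_reg_def)
qed

end
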